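(* Let $X$ be a finite non-empty set and $P\in\mathfrak{P}(X)$. If $P$ is connected and $\mathrm{Crit}(P)\subseteq L(P)\times U(P)$, then $P$ is $\mathfrak{U}$-shielded. Moreover, if $P$ has an FPP-graph, then the converse also holds: if $P$ is $\mathfrak{U}$-shielded, then $\mathrm{Crit}(P)\subseteq L(P)\times U(P)$.
   Context: For a finite non-empty set $X$, $\mathfrak{P}(X)$ is the set of all posets with carrier $X$, ordered by $P\sqsubseteq Q$ iff $\leq_P\subseteq\leq_Q$; $\mathfrak{U}(P)$ denotes the set of upper covers of $P$ in $(\mathfrak{P}(X),\sqsubseteq)$. For a poset $P$: $[x,y]_P=\{z: x\leq_P z\leq_P y\}$; $x\lessdot_P y$ means $x<_P y$ and $[x,y]_P=\{x,y\}$; $L(P)$, $U(P)$ are the sets of minimal and maximal elements, $M(P)=X\setminus(L(P)\cup U(P))$; $\prec_P=\{(a,b)\in<_P: M(P)\cap[a,b]_P=\emptyset\}$. $P\setminus(a,b)=(X,\leq_P\setminus\{(a,b)\})$. $P$ is connected iff its comparability graph is connected. $P$ has an FPP-graph iff $P$ is connected and $P\setminus(a,b)$ is disconnected for all $(a,b)\in\prec_P$. $P$ is $\mathfrak{U}$-shielded iff no poset in $\mathfrak{U}(P)$ has an FPP-graph. $\mathrm{Crit}(P)$ (critical pairs) is the set of $(a,b)\in X\times X$ with $a,b$ incomparable in $P$, $\{z: z<_P a\}\subseteq\{z: z<_P b\}$ and $\{z: b<_P z\}\subseteq\{z: a<_P z\}$. *)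

theory Defs
  imports Main
begin

text \<open>A poset with carrier \<open>X\<close> is represented by its (reflexive) order relation \<open>P \<subseteq> X \<times> X\<close>;
  the strict order is \<open>P - Id\<close>, and \<open>P \<sqsubseteq> Q\<close> is plain inclusion of relations.\<close>

definition posets :: "'a set \<Rightarrow> 'a rel set" where
  "posets X = {P. partial_order_on X P}"

definition upper_covers :: "'a set \<Rightarrow> 'a rel \<Rightarrow> 'a rel set" where
  "upper_covers X P =
     {Q \<in> posets X. P \<subset> Q \<and> \<not> (\<exists>R \<in> posets X. P \<subset> R \<and> R \<subset> Q)}"

definition order_interval :: "'a set \<Rightarrow> 'a rel \<Rightarrow> 'a \<Rightarrow> 'a \<Rightarrow> 'a set" where
  "order_interval X P x y = {z \<in> X. (x, z) \<in> P \<and> (z, y) \<in> P}"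

definition min_elems :: "'a set \<Rightarrow> 'a rel \<Rightarrow> 'a set" where
  "min_elems X P = {x \<in> X. \<not> (\<exists>y \<in> X. (y, x) \<in> P - Id)}"

definition max_elems :: "'a set \<Rightarrow> 'a rel \<Rightarrow> 'a set" where
  "max_elems X P = {x \<in> X. \<not> (\<exists>y \<in> X. (x, y) \<in> P - Id)}"

definition mid_elems :: "'a set \<Rightarrow> 'a rel \<Rightarrow> 'a set" where
  "mid_elems X P = X - (min_elems X P \<union> max_elems X P)"

definition prec_pairs :: "'a set \<Rightarrow> 'a rel \<Rightarrow> 'a rel" where
  "prec_pairs X P = {(a, b). (a, b) \<in> P - Id \<and> mid_elems X P \<inter> order_interval X P a b = {}}"

definition comparability_edges :: "'a set \<Rightarrow> 'a rel \<Rightarrow> 'a rel" where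
  "comparability_edges X P =
     {(x, y). x \<in> X \<and> y \<in> X \<and> x \<noteq> y \<and> ((x, y) \<in> P \<or> (y, x) \<in> P)}"

definition poset_connected :: "'a set \<Rightarrow> 'a rel \<Rightarrow> bool" where
  "poset_connected X P \<longleftrightarrow> (\<forall>x \<in> X. \<forall>y \<in> X. (x, y) \<in> (comparability_edges X P)\<^sup>*)"

definition has_FPP_graph :: "'a set \<Rightarrow> 'a rel \<Rightarrow> bool" where
  "has_FPP_graph X P \<longleftrightarrow>
     poset_connected X P \<and>
     (\<forall>(a, b) \<in> prec_pairs X P. \<not> poset_connected X (P - {(a, b)}))"

definition U_shielded :: "'a set \<Rightarrow> 'a rel \<Rightarrow> bool" where
  "U_shielded X P \<longleftrightarrow> \<not> (\<exists>Q \<in> upper_covers X P. has_FPP_graph X Q)"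

definition critical_pairs :: "'a set \<Rightarrow> 'a rel \<Rightarrow> 'a rel" where
  "critical_pairs X P =
     {(a, b) \<in> X \<times> X. (a, b) \<notin> P \<and> (b, a) \<notin> P \<and>
        {z \<in> X. (z, a) \<in> P - Id} \<subseteq> {z \<in> X. (z, b) \<in> P - Id} \<and>
        {z \<in> X. (b, z) \<in> P - Id} \<subseteq> {z \<in> X. (a, z) \<in> P - Id}}"

end

theory Submission
  imports Defs
begin

text \<open>The upper covers of \<open>P\<close> are exactly the posets \<open>P \<union> {(a, b)}\<close> with \<open>(a, b)\<close> critical.
  If \<open>a\<close> is minimal and \<open>b\<close> maximal, then \<open>(a, b)\<close> belongs to \<open>\<prec>\<close> of that cover and removing it
  gives back the connected poset \<open>P\<close>, so the cover has no FPP-graph.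
  If, say, \<open>a\<close> is not minimal, then some \<open>z < a\<close> also satisfies \<open>z < b\<close>. As \<open>a\<close> is a middle
  element of the cover, no pair of \<open>\<prec>\<close> equals \<open>(a, b)\<close>, \<open>(z, a)\<close> or \<open>(z, b)\<close>; hence
  \<open>a\<close> and \<open>b\<close> stay joined through \<open>z\<close> after removal of such a pair, so that adding \<open>(a, b)\<close> does
  not reconnect what the removal disconnects in \<open>P\<close>.\<close>

lemma posets_iff:
  "P \<in> posets X \<longleftrightarrow> P \<subseteq> X \<times> X \<and> (\<forall>x\<in>X. (x, x) \<in> P) \<and> trans P \<and> antisym P"
  unfolding posets_def partial_order_on_def preorder_on_def refl_on_def by auto

text \<open>The two inclusions in criticality are what transitivity needs for the chains
  \<open>z < a < b\<close> and \<open>a < b < z\<close>; incomparability preserves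
  antisymmetry.\<close>

lemma insert_critical_pair_in_posets:
  assumes P: "P \<in> posets X" and ab: "(a, b) \<in> critical_pairs X P"
  shows "insert (a, b) P \<in> posets X"
proof -
  have X: "P \<subseteq> X \<times> X" "a \<in> X" "b \<in> X"
    and refl: "\<And>x. x \<in> X \<Longrightarrow> (x, x) \<in> P" and tr: "trans P" and as: "antisym P"
    and inc: "(a, b) \<notin> P" "(b, a) \<notin> P"
    using P ab by (auto simp: posets_iff critical_pairs_def)
  have low: "(z, b) \<in> P" if "(z, a) \<in> P" "z \<noteq> a" for z
    using ab X that by (auto simp: critical_pairs_def)
  have up: "(a, z) \<in> P" if "(b, z) \<in> P" "z \<noteq> b" for z
    using ab X that by (auto simp: critical_pairs_def)
  have "trans (insert (a, b) P)"
  proof (rule transI)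
    fix x y z assume "(x, y) \<in> insert (a, b) P" "(y, z) \<in> insert (a, b) P"
    then show "(x, z) \<in> insert (a, b) P"
      using low[of x] up[of z] transD[OF tr, of x y z] inc by auto
  qed
  moreover have "antisym (insert (a, b) P)"
  proof (rule antisymI)
    fix x y assume "(x, y) \<in> insert (a, b) P" "(y, x) \<in> insert (a, b) P"
    then show "x = y" using antisymD[OF as, of x y] inc by auto
  qed
  ultimately show ?thesis using X refl by (auto simp: posets_iff)
qed

text \<open>Replacing \<open>a\<close> by a lower element or \<open>b\<close> by a higher one shrinks the down-set of \<open>a\<close> or the
  up-set of \<open>b\<close>, so a pair minimising the sum of their sizes is critical.\<close>

lemma critical_pair_in_extension:
  assumes "finite X" and P: "P \<in> posets X" and Q: "Q \<in> posets X" and "P \<subset> Q"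
  obtains a b where "(a, b) \<in> critical_pairs X P" "(a, b) \<in> Q"
proof -
  define m where "m = (\<lambda>(a, b). card {z. (z, a) \<in> P} + card {z. (b, z) \<in> P})"
  have PX: "P \<subseteq> X \<times> X" and refl: "\<And>x. x \<in> X \<Longrightarrow> (x, x) \<in> P"
    and tr: "trans P" and as: "antisym P"
    using P by (auto simp: posets_iff)
  have QX: "Q \<subseteq> X \<times> X" and trQ: "trans Q" and asQ: "antisym Q"
    using Q by (auto simp: posets_iff)
  have fin: "finite {z. (z, x) \<in> P}" "finite {z. (x, z) \<in> P}" for x
    using PX by (auto intro: finite_subset[OF _ \<open>finite X\<close>])
  obtain p where "p \<in> Q - P" using \<open>P \<subset> Q\<close> by auto
  then obtain q where q: "q \<in> Q - P" and min: "\<And>r. r \<in> Q - P \<Longrightarrow> m q \<le> m r"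
    using ex_has_least_nat[of "\<lambda>p. p \<in> Q - P" p m] by blast
  obtain a b where q_eq: "q = (a, b)" by (cases q)
  have ab: "(a, b) \<in> Q" "(a, b) \<notin> P" "a \<in> X" "b \<in> X" using q QX q_eq by auto
  then have "a \<noteq> b" using refl by auto
  \<comment> \<open>Incomparability in \<open>P\<close> is inherited from antisymmetry of the larger
    order \<open>Q\<close>.\<close>
  then have ba: "(b, a) \<notin> Q" using antisymD[OF asQ] ab by blast
  have low: "(z, b) \<in> P" if z: "(z, a) \<in> P" "z \<noteq> a" for z
  proof (rule ccontr)
    assume "(z, b) \<notin> P"
    then have "(z, b) \<in> Q - P" using z ab \<open>P \<subset> Q\<close> transD[OF trQ] by blast
    \<comment> \<open>Strict because \<open>a\<close> lies only in the right-hand set: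
      \<open>a \<le> z \<le> a\<close> would force \<open>z = a\<close>.\<close>
    moreover have "{w. (w, z) \<in> P} \<subset> {w. (w, a) \<in> P}"
      using z transD[OF tr] antisymD[OF as] refl[OF ab(3)] by blast
    then have "m (z, b) < m (a, b)" by (simp add: m_def psubset_card_mono fin)
    ultimately show False using min q_eq by force
  qed
  have up: "(a, z) \<in> P" if z: "(b, z) \<in> P" "z \<noteq> b" for z
  proof (rule ccontr)
    assume "(a, z) \<notin> P"
    then have "(a, z) \<in> Q - P" using z ab \<open>P \<subset> Q\<close> transD[OF trQ] by blast
    moreover have "{w. (z, w) \<in> P} \<subset> {w. (b, w) \<in> P}"
      using z transD[OF tr] antisymD[OF as] refl[OF ab(4)] by blast
    then have "m (a, z) < m (a, b)" by (simp add: m_def psubset_card_mono fin)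
    ultimately show False using min q_eq by force
  qed
  have "(a, b) \<in> critical_pairs X P"
    using ab ba low up \<open>P \<subset> Q\<close> by (auto simp: critical_pairs_def)
  then show ?thesis using that ab by blast
qed

text \<open>Every proper extension contains some \<open>insert (a, b) P\<close> with
  \<open>(a, b)\<close> critical, so a cover must equal it. Conversely, one added pair leaves no
  room for an order strictly between.\<close>

lemma upper_covers_eq:
  assumes "finite X" and P: "P \<in> posets X"
  shows "upper_covers X P = (\<lambda>p. insert p P) ` critical_pairs X P"
proof (intro equalityI subsetI)
  fix Q assume Q: "Q \<in> upper_covers X P"
  then obtain a b where ab: "(a, b) \<in> critical_pairs X P" "(a, b) \<in> Q"
    using critical_pair_in_extension[OF assms, of Q] by (auto simp: upper_covers_def)
  then have "P \<subset> insert (a, b) P" by (auto simp: critical_pairs_def)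
  moreover have "insert (a, b) P \<subseteq> Q" using Q ab by (auto simp: upper_covers_def)
  ultimately have "Q = insert (a, b) P"
    using insert_critical_pair_in_posets[OF P ab(1)] Q by (auto simp: upper_covers_def)
  then show "Q \<in> (\<lambda>p. insert p P) ` critical_pairs X P" using ab by blast
next
  fix Q assume "Q \<in> (\<lambda>p. insert p P) ` critical_pairs X P"
  then obtain a b where ab: "(a, b) \<in> critical_pairs X P" "Q = insert (a, b) P" by auto
  moreover have "(a, b) \<notin> P" using ab by (auto simp: critical_pairs_def)
  ultimately show "Q \<in> upper_covers X P"
    using insert_critical_pair_in_posets[OF P] by (auto simp: upper_covers_def)
qed

lemma comparability_edges_mono:
  "P \<subseteq> Q \<Longrightarrow> comparability_edges X P \<subseteq> comparability_edges X Q"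
  by (auto simp: comparability_edges_def)

lemma poset_connected_mono:
  "poset_connected X P \<Longrightarrow> P \<subseteq> Q \<Longrightarrow> poset_connected X Q"
  unfolding poset_connected_def
  using rtrancl_mono[OF comparability_edges_mono] by blast

lemma comparability_edges_sym: "sym (comparability_edges X P)"
  by (auto simp: sym_def comparability_edges_def)

text \<open>Each use of the edge can be rerouted along a path in the rest. \<open>P\<close> may be
  any relation, since the lemma is applied to a poset with a pair removed.\<close>

lemma poset_connected_delete_edge:
  assumes "poset_connected X (insert (a, b) P)"
    and "(a, b) \<in> (comparability_edges X P)\<^sup>*"
  shows "poset_connected X P"
proof -
  have "(b, a) \<in> (comparability_edges X P)\<^sup>*"
    by (rule symD[OF sym_rtrancl[OF comparability_edges_sym] assms(2)])
  then have "comparability_edges X (insert (a, b) P) \<subseteq> (comparability_edges X P)\<^sup>*"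
    using assms(2) by (auto simp: comparability_edges_def)
  then have "(comparability_edges X (insert (a, b) P))\<^sup>* \<subseteq> (comparability_edges X P)\<^sup>*"
    by (rule rtrancl_subset_rtrancl)
  then show ?thesis using assms(1) unfolding poset_connected_def by blast
qed

lemma insert_min_max_pair_not_FPP:
  assumes conn: "poset_connected X P"
    and ab: "(a, b) \<in> critical_pairs X P" "a \<in> min_elems X P" "b \<in> max_elems X P"
    and P: "P \<in> posets X"
  shows "\<not> has_FPP_graph X (insert (a, b) P)"
proof -
  let ?Q = "insert (a, b) P"
  have inc: "(a, b) \<notin> P" "a \<noteq> b" "trans P"
    using ab P by (auto simp: critical_pairs_def posets_iff)
  have "a \<in> min_elems X ?Q" "b \<in> max_elems X ?Q"
    using ab inc by (auto simp: min_elems_def max_elems_def)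
  \<comment> \<open>An element strictly between would lie between \<open>a\<close> and
    \<open>b\<close> already in \<open>P\<close>, forcing \<open>(a, b) \<in> P\<close>.\<close>
  moreover have "order_interval X ?Q a b \<subseteq> {a, b}"
    using inc transD[OF inc(3), of a _ b] by (auto simp: order_interval_def)
  ultimately have "(a, b) \<in> prec_pairs X ?Q"
    using inc by (auto simp: prec_pairs_def mid_elems_def)
  moreover have "?Q - {(a, b)} = P" using inc by auto
  then have "poset_connected X (?Q - {(a, b)})" using conn by (simp only:)
  ultimately show ?thesis unfolding has_FPP_graph_def by blast
qed

lemma insert_critical_pair_FPP:
  assumes P: "P \<in> posets X" and fpp: "has_FPP_graph X P"
    and ab: "(a, b) \<in> critical_pairs X P"
    and not_LU: "(a, b) \<notin> min_elems X P \<times> max_elems X P"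
  shows "has_FPP_graph X (insert (a, b) P)"
proof -
  let ?Q = "insert (a, b) P"
  have X: "P \<subseteq> X \<times> X" "a \<in> X" "b \<in> X" and refl: "\<And>x. x \<in> X \<Longrightarrow> (x, x) \<in> P"
    and inc: "(a, b) \<notin> P" "(b, a) \<notin> P"
    using P ab by (auto simp: posets_iff critical_pairs_def)
  have "a \<noteq> b" using inc refl X by auto
  have mid: "mid_elems X P \<subseteq> mid_elems X ?Q"
    by (auto simp: mid_elems_def min_elems_def max_elems_def)
  have "\<not> poset_connected X (?Q - {(x, y)})" if xy: "(x, y) \<in> prec_pairs X ?Q" for x y
  proof
    assume "poset_connected X (?Q - {(x, y)})"
    have not_mid: "w \<notin> mid_elems X ?Q" if "w \<in> X" "(x, w) \<in> ?Q" "(w, y) \<in> ?Q" for w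
      using xy that unfolding prec_pairs_def order_interval_def by blast
    \<comment> \<open>The inequality puts \<open>(x, y)\<close> in \<open>P\<close> and lets
      deletion commute with insertion; the path makes the new edge redundant.\<close>
    have joined: "(x, y) \<noteq> (a, b) \<and> (a, b) \<in> (comparability_edges X (P - {(x, y)}))\<^sup>*"
    proof (cases "a \<in> min_elems X P")
      case False
      then obtain z where z: "z \<in> X" "(z, a) \<in> P" "z \<noteq> a"
        using X by (auto simp: min_elems_def)
      then have zb: "(z, b) \<in> P" "z \<noteq> b" using ab by (auto simp: critical_pairs_def)
      \<comment> \<open>Even if \<open>a\<close> is maximal in \<open>P\<close>, the new pair puts
        \<open>b\<close> above it.\<close>
      have "a \<in> mid_elems X ?Q"
        using z X \<open>a \<noteq> b\<close> by (auto simp: mid_elems_def min_elems_def max_elems_def)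
      \<comment> \<open>In \<open>?Q\<close>, the middle element \<open>a\<close> lies in the
        intervals of all three pairs, in that of \<open>(z, b)\<close> thanks to the new
        pair.\<close>
      then have ne: "(x, y) \<noteq> (a, b)" "(x, y) \<noteq> (z, a)" "(x, y) \<noteq> (z, b)"
        using not_mid[of a] X refl z by auto
      then have "(a, z) \<in> comparability_edges X (P - {(x, y)})"
        "(z, b) \<in> comparability_edges X (P - {(x, y)})"
        using z zb X by (auto simp: comparability_edges_def)
      then show ?thesis using ne by (meson r_into_rtrancl rtrancl_trans)
    next
      case True
      \<comment> \<open>The order-dual case: \<open>z\<close> is now above \<open>b\<close>, and
        \<open>b\<close> is the middle element.\<close>
      then have "b \<notin> max_elems X P" using not_LU by auto
      then obtain z where z: "z \<in> X" "(b, z) \<in> P" "z \<noteq> b"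
        using X by (auto simp: max_elems_def)
      then have az: "(a, z) \<in> P" "z \<noteq> a" using ab by (auto simp: critical_pairs_def)
      have "b \<in> mid_elems X ?Q"
        using z X \<open>a \<noteq> b\<close> by (auto simp: mid_elems_def min_elems_def max_elems_def)
      then have ne: "(x, y) \<noteq> (a, b)" "(x, y) \<noteq> (b, z)" "(x, y) \<noteq> (a, z)"
        using not_mid[of b] X refl z by auto
      then have "(a, z) \<in> comparability_edges X (P - {(x, y)})"
        "(z, b) \<in> comparability_edges X (P - {(x, y)})"
        using z az X by (auto simp: comparability_edges_def)
      then show ?thesis using ne by (meson r_into_rtrancl rtrancl_trans)
    qed
    then have "?Q - {(x, y)} = insert (a, b) (P - {(x, y)})" by auto
    then have "poset_connected X (P - {(x, y)})"
      using \<open>poset_connected X (?Q - {(x, y)})\<close> joined poset_connected_delete_edge by metis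
    moreover have "(x, y) \<in> prec_pairs X P"
    proof -
      have "(x, y) \<in> ?Q - Id" "mid_elems X ?Q \<inter> order_interval X ?Q x y = {}"
        using xy by (simp_all only: prec_pairs_def mem_Collect_eq case_prod_conv)
      \<comment> \<open>Passing from \<open>?Q\<close> back to \<open>P\<close> shrinks both the
        interval and the set of middle elements, so they stay disjoint.\<close>
      moreover have "order_interval X P x y \<subseteq> order_interval X ?Q x y"
        by (auto simp: order_interval_def)
      ultimately have "(x, y) \<in> P - Id" "mid_elems X P \<inter> order_interval X P x y = {}"
        using joined mid by auto
      then show ?thesis by (simp add: prec_pairs_def)
    qed
    ultimately show False using fpp unfolding has_FPP_graph_def by blast
  qed
  moreover have "poset_connected X ?Q"
    using fpp poset_connected_mono[of X P ?Q] unfolding has_FPP_graph_def by blast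
  ultimately show ?thesis unfolding has_FPP_graph_def by blast
qed

theorem theorem2:
  fixes X :: "'a set" and P :: "'a rel"
  assumes "finite X" and "X \<noteq> {}" and "P \<in> posets X"
  shows "(poset_connected X P \<and> critical_pairs X P \<subseteq> min_elems X P \<times> max_elems X P
            \<longrightarrow> U_shielded X P) \<and>
         (has_FPP_graph X P \<longrightarrow>
            (U_shielded X P \<longrightarrow> critical_pairs X P \<subseteq> min_elems X P \<times> max_elems X P))"
proof (intro conjI impI)
  assume "poset_connected X P \<and> critical_pairs X P \<subseteq> min_elems X P \<times> max_elems X P"
  then show "U_shielded X P"
    using insert_min_max_pair_not_FPP[OF _ _ _ _ assms(3)]
    unfolding U_shielded_def upper_covers_eq[OF assms(1,3)] by blast
next
  assume "has_FPP_graph X P" "U_shielded X P"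
  then show "critical_pairs X P \<subseteq> min_elems X P \<times> max_elems X P"
    using insert_critical_pair_FPP[OF assms(3)]
    unfolding U_shielded_def upper_covers_eq[OF assms(1,3)] by fast
qed

end
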